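(* Every finite connected simple graph is (isomorphic to) an induced subgraph of an SR-graph.
   Context: $\gamma(G)$ denotes the domination number of a finite simple graph $G$. For an edge $e=uv$ of $G$, $G-e$ is the graph obtained by deleting $e$, and $G_e$ is the graph obtained by subdividing $e$: delete $e$, add a new vertex $w$ and the edges $uw$ and $wv$. A finite connected simple graph $G$ of order at least two is an SR-graph (sub-removable graph) if $\gamma(G-e)=\gamma(G_e)$ for every edge $e$ of $G$. *)

theory Defs
  imports "Graph_Theory.Graph_Theory" "HOL-Library.Infinite_Typeclass"
begin

text \<open>
  Finite simple graphs are the models of the locale \<^locale>\<open>pair_graph\<close>: finitely many vertices and a
  symmetric, loop-free arc relation, so that an edge $uv$ is the pair of arcs \<open>(u,v)\<close>, \<open>(v,u)\<close>.
  The predicate \<open>Digraph_Component.connected\<close> excludes the graph without vertices.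
\<close>

definition dominating_set :: "'a pair_pre_digraph \<Rightarrow> 'a set \<Rightarrow> bool" where
  "dominating_set G D \<longleftrightarrow> D \<subseteq> pverts G \<and> (\<forall>v \<in> pverts G - D. \<exists>u \<in> D. (u, v) \<in> parcs G)"

text \<open>Only meaningful for graphs with finitely many vertices.\<close>

definition domination_number :: "'a pair_pre_digraph \<Rightarrow> nat" where
  "domination_number G = Min (card ` {D. dominating_set G D})"

fun delete_edge :: "'a pair_pre_digraph \<Rightarrow> 'a \<times> 'a \<Rightarrow> 'a pair_pre_digraph" where
  "delete_edge G (u, v) = \<lparr> pverts = pverts G, parcs = parcs G - {(u, v), (v, u)} \<rparr>"

text \<open>
  The new vertex \<open>w\<close> of a subdivision may be any vertex outside of \<open>G\<close>; up to isomorphism the choice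
  is irrelevant. The sort constraint \<^class>\<open>infinite\<close> guarantees that such a \<open>w\<close> exists for finite \<open>G\<close>,
  so that the quantification over \<open>w\<close> is never vacuous.
\<close>

definition SR_graph :: "'a::infinite pair_pre_digraph \<Rightarrow> bool" where
  "SR_graph G \<longleftrightarrow>
     pair_graph G \<and> Digraph_Component.connected (with_proj G) \<and> 2 \<le> card (pverts G) \<and>
     (\<forall>e \<in> parcs G. \<forall>w. w \<notin> pverts G \<longrightarrow>
        domination_number (delete_edge G e) = domination_number (subdivide G e w))"

end

theory Submission
  imports Defs
begin

text \<open>
  Attach at least two leaves to every vertex of the given graph $K$, and let $n$ be the order of $K$.
  A set of $n$ leaves, one for each vertex of $K$, has pairwise disjoint closed neighbourhoods, while
  the vertices of $K$ form a dominating set. Neither is affected by deleting or subdividing an edge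
  of $K$, so both operations give domination number $n$. After deleting or subdividing the edge at a
  leaf $l$, the vertices of $K$ and $l$ form a dominating set, and $l$ extends a set of $n$ other
  leaves with the above property, so both operations give $n + 1$.
\<close>

section \<open>Lower bounds on domination from packings\<close>

text \<open>Weak duality of packing and domination: by \<open>packing\<close>, the members of
  \<open>P\<close> have pairwise disjoint closed in-neighbourhoods, so choosing a dominator for each
  of them is an injection of \<open>P\<close> into any dominating set. Thus \<open>card P\<close> is
  a lower bound, and \<open>D\<close> attains it.\<close>

lemma domination_number_eqI:
  assumes "finite (pverts G)" "dominating_set G D" "P \<subseteq> pverts G" "card P = card D"
    and packing: "\<And>v x y. \<lbrakk>x \<in> P; y \<in> P; v = x \<or> (v, x) \<in> parcs G; v = y \<or> (v, y) \<in> parcs G\<rbrakk> \<Longrightarrow> x = y"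
  shows "domination_number G = card D"
proof -
  have "card D \<le> card D'" if D': "dominating_set G D'" for D'
  proof -
    have "\<exists>u\<in>D'. u = x \<or> (u, x) \<in> parcs G" if "x \<in> P" for x
      using that D' assms(3) unfolding dominating_set_def by blast
    then obtain d where d: "\<And>x. x \<in> P \<Longrightarrow> d x \<in> D' \<and> (d x = x \<or> (d x, x) \<in> parcs G)"
      by metis
    have "inj_on d P"
      by (rule inj_onI) (metis d packing)
    moreover have "d ` P \<subseteq> D'" using d by blast
    moreover have "finite D'"
      using D' assms(1) finite_subset unfolding dominating_set_def by blast
    ultimately show ?thesis using card_inj_on_le assms(4) by metis
  qed
  moreover have "finite {D'. dominating_set G D'}"
    using assms(1) by (auto intro: finite_subset[of _ "Pow (pverts G)"] simp: dominating_set_def)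
  ultimately show ?thesis
    unfolding domination_number_def using assms(2) by (intro Min_eqI) auto
qed

section \<open>Attaching leaves to a graph\<close>

text \<open>The map \<open>p\<close> sends a leaf to its only neighbour. The leaves are taken from
  the vertex type of \<open>K\<close>, so that \<open>K\<close> itself, and not merely a copy, lies
  in the new graph.\<close>

definition attach_leaves :: "'a pair_pre_digraph \<Rightarrow> ('a \<Rightarrow> 'a) \<Rightarrow> 'a set \<Rightarrow> 'a pair_pre_digraph" where
  "attach_leaves K p L =
     \<lparr> pverts = pverts K \<union> L, parcs = parcs K \<union> (\<Union>x\<in>L. {(x, p x), (p x, x)}) \<rparr>"

lemma attach_leaves_simps [simp]:
  "pverts (attach_leaves K p L) = pverts K \<union> L"
  "parcs (attach_leaves K p L) = parcs K \<union> (\<Union>x\<in>L. {(x, p x), (p x, x)})"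
  by (simp_all add: attach_leaves_def)

lemma delete_edge_swap: "delete_edge G (v, u) = delete_edge G (u, v)"
  by (simp add: insert_commute)

lemma subdivide_swap: "subdivide G (v, u) w = subdivide G (u, v) w"
  by (simp add: subdivide.simps insert_commute)

text \<open>The assumption \<open>other_leaf\<close> encodes that each vertex has at least two
  leaves: as \<open>l\<close> is arbitrary, a leaf remains whichever one is excluded.\<close>

locale two_leaves = K: pair_graph K for K :: "'a pair_pre_digraph" +
  fixes p :: "'a \<Rightarrow> 'a" and L :: "'a set"
  assumes finite_L: "finite L"
    and disjoint: "L \<inter> pverts K = {}"
    and p_in: "x \<in> L \<Longrightarrow> p x \<in> pverts K"
    and other_leaf: "v \<in> pverts K \<Longrightarrow> \<exists>x\<in>L. x \<noteq> l \<and> p x = v"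
begin

abbreviation "H \<equiv> attach_leaves K p L"

lemma pair_graph_H: "pair_graph H"
proof -
  have p_neq: "p x \<noteq> x" if "x \<in> L" for x
    using p_in[OF that] that disjoint by auto
  have "symmetric (with_proj H)"
    using K.arcs_symmetric by (auto simp: symmetric_def intro!: symI)
  then show ?thesis
    using K.pair_finite_verts K.pair_finite_arcs finite_L p_in p_neq p_neq[symmetric]
    by unfold_locales (auto dest: K.wellformed' K.no_loops')
qed

lemma induced_subgraph_H: "induced_subgraph (with_proj K) (with_proj H)"
proof -
  interpret H: pair_graph H by (rule pair_graph_H)
  show ?thesis
    using disjoint H.wf_digraph K.wf_digraph
    by (auto simp: induced_subgraph_def subgraph_def compatible_def dest: K.wellformed')
qed

lemma connected_H:
  assumes "Digraph_Component.connected (with_proj K)"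
  shows "Digraph_Component.connected (with_proj H)"
proof -
  let ?R = "rtrancl_on (pverts H) ((parcs H)\<^sup>s)"
  \<comment> \<open>The retraction of \<open>H\<close> onto \<open>K\<close>: any \<open>u\<close>
    and \<open>v\<close> are joined by way of \<open>q u\<close> and \<open>q v\<close>, which are
    connected inside \<open>K\<close>.\<close>
  define q where "q x = (if x \<in> L then p x else x)" for x
  have q_in: "q x \<in> pverts K" if "x \<in> pverts H" for x
    using that p_in by (auto simp: q_def)
  have K: "(u, v) \<in> ?R" if "u \<in> pverts K" "v \<in> pverts K" for u v
  proof (rule rtrancl_on_mono)
    show "(u, v) \<in> rtrancl_on (pverts K) ((parcs K)\<^sup>s)"
      using assms that by (simp add: connected_conv)
  qed (auto simp: symcl_def)
  have to_q: "(x, q x) \<in> ?R" and from_q: "(q x, x) \<in> ?R" if "x \<in> pverts H" for x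
  proof -
    have "(x, x) \<in> ?R" "(q x, q x) \<in> ?R" using that q_in by auto
    moreover have "x = q x \<or> (x, q x) \<in> (parcs H)\<^sup>s \<and> (q x, x) \<in> (parcs H)\<^sup>s"
      by (auto simp: q_def symcl_def)
    ultimately show "(x, q x) \<in> ?R" "(q x, x) \<in> ?R"
      using that q_in[OF that] by (auto intro: rtrancl_on_into_rtrancl_on)
  qed
  have "(u, v) \<in> ?R" if "u \<in> pverts H" "v \<in> pverts H" for u v
    using rtrancl_on_trans[OF to_q[OF that(1)] rtrancl_on_trans[OF K from_q[OF that(2)]]] q_in that
    by blast
  moreover have "pverts H \<noteq> {}"
    using assms by (simp add: connected_conv)
  ultimately show ?thesis by (simp add: connected_conv)
qed

text \<open>Supplies the packing of one leaf per vertex, avoiding the leaf \<open>l\<close> whose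
  edge is to be changed.\<close>

lemma leaf_choice:
  obtains s where "\<And>v. v \<in> pverts K \<Longrightarrow> s v \<in> L \<and> s v \<noteq> l \<and> p (s v) = v"
  using other_leaf[of _ l] by metis

lemma leaf_neighbour:
  assumes "x \<in> L" "(a, x) \<in> parcs H"
  shows "a = p x"
  using assms disjoint p_in by (auto dest: K.wellformed')

text \<open>Parents lie in \<open>K\<close> and leaves do not, so a common element of
  {\<open>x\<close>, \<open>p x\<close>} and {\<open>y\<close>, \<open>p y\<close>} is a leaf in
  both roles or a parent in both.\<close>

lemma parent_eq:
  assumes "x \<in> L" "y \<in> L" "a = x \<or> a = p x" "a = y \<or> a = p y"
  shows "p x = p y"
  using assms disjoint p_in by blast

section \<open>Deleting and subdividing edges\<close>

lemma inner_edge: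
  assumes "(u, v) \<in> parcs K" "w \<notin> pverts H"
  shows "domination_number (delete_edge H (u, v)) = card (pverts K)"
    and "domination_number (subdivide H (u, v) w) = card (pverts K)"
proof -
  obtain s where s: "\<And>x. x \<in> pverts K \<Longrightarrow> s x \<in> L \<and> p (s x) = x"
    using leaf_choice by metis
  let ?P = "s ` pverts K"
  have P: "?P \<subseteq> L" using s by blast
  have card: "card ?P = card (pverts K)"
    by (rule card_image) (metis s inj_onI)
  define X where "X = delete_edge H (u, v)"
  define X' where "X' = subdivide H (u, v) w"
  have verts: "pverts X = pverts K \<union> L" "pverts X' = insert w (pverts K \<union> L)"
    by (simp_all add: X_def X'_def)
  have fin: "finite (pverts X)" "finite (pverts X')"
    using verts K.pair_finite_verts finite_L by simp_all
  have uv: "u \<in> pverts K" "v \<in> pverts K" using K.wellformed'[OF assms(1)] by auto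
  then have uvL: "u \<notin> L" "v \<notin> L" using disjoint by auto
  \<comment> \<open>The packing property is shown once in \<open>H\<close>; it passes to
    \<open>X\<close> and \<open>X'\<close> because their arcs into leaves are already arcs of
    \<open>H\<close>. Injectivity of \<open>s\<close> comes from its left inverse
    \<open>p\<close>.\<close>
  have eq: "x = y" if "x \<in> ?P" "y \<in> ?P" "a = x \<or> (a, x) \<in> parcs H" "a = y \<or> (a, y) \<in> parcs H" for a x y
  proof -
    have "x \<in> L" "y \<in> L" using that P by auto
    then have "p x = p y"
      using that(3,4) leaf_neighbour parent_eq[of x y a] by blast
    moreover have "s (p x) = x" "s (p y) = y" using that(1,2) s by auto
    ultimately show ?thesis by metis
  qed
  have dominated: "\<exists>c\<in>pverts K. (c, x) \<in> parcs X"
    "\<exists>c\<in>pverts K. (c, x) \<in> parcs X'"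
    if "x \<in> L" for x
  proof -
    have "(p x, x) \<in> parcs X" "(p x, x) \<in> parcs X'"
      using that uvL by (auto simp: X_def X'_def)
    then show "\<exists>c\<in>pverts K. (c, x) \<in> parcs X"
      "\<exists>c\<in>pverts K. (c, x) \<in> parcs X'"
      using p_in[OF that(1)] by - blast+
  qed
  show "domination_number (delete_edge H (u, v)) = card (pverts K)"
    unfolding X_def[symmetric]
  proof (rule domination_number_eqI[OF _ _ _ card])
    show "dominating_set X (pverts K)"
      unfolding dominating_set_def verts using dominated(1) by auto
    have "(a, x) \<in> parcs H" if "(a, x) \<in> parcs X" for a x
      using that by (auto simp: X_def)
    then show "x = y"
      if "x \<in> ?P" "y \<in> ?P" "a = x \<or> (a, x) \<in> parcs X" "a = y \<or> (a, y) \<in> parcs X" for a x y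
      using that eq by blast
  qed (use fin P verts in auto)
  show "domination_number (subdivide H (u, v) w) = card (pverts K)"
    unfolding X'_def[symmetric]
  proof (rule domination_number_eqI[OF _ _ _ card])
    have "(u, w) \<in> parcs X'" by (simp add: X'_def)
    then show "dominating_set X' (pverts K)"
      unfolding dominating_set_def verts using dominated(2) uv(1) by auto
    \<comment> \<open>The arcs created by the subdivision end in \<open>u\<close>, \<open>v\<close>
      or \<open>w\<close>, none of which is a leaf.\<close>
    have "(a, x) \<in> parcs H" if "x \<in> L" "(a, x) \<in> parcs X'" for a x
      using that uvL assms(2) by (auto simp: X'_def)
    then show "x = y"
      if "x \<in> ?P" "y \<in> ?P" "a = x \<or> (a, x) \<in> parcs X'" "a = y \<or> (a, y) \<in> parcs X'" for a x y
      using that P eq by blast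
  qed (use fin P verts in auto)
qed

lemma leaf_edge:
  assumes "l \<in> L" "w \<notin> pverts H"
  shows "domination_number (delete_edge H (l, p l)) = Suc (card (pverts K))"
    and "domination_number (subdivide H (l, p l) w) = Suc (card (pverts K))"
proof -
  obtain s where s: "\<And>x. x \<in> pverts K \<Longrightarrow> s x \<in> L \<and> s x \<noteq> l \<and> p (s x) = x"
    using leaf_choice[of l] by metis
  let ?P = "s ` pverts K"
  have P: "?P \<subseteq> L" "l \<notin> ?P" using s by auto
  have "card ?P = card (pverts K)"
    by (rule card_image) (metis s inj_onI)
  moreover have lK: "l \<notin> pverts K" using assms(1) disjoint by auto
  ultimately have card: "card (insert l ?P) = card (insert l (pverts K))"
    and cardD: "card (insert l (pverts K)) = Suc (card (pverts K))"
    using P K.pair_finite_verts by auto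
  define X where "X = delete_edge H (l, p l)"
  define X' where "X' = subdivide H (l, p l) w"
  have verts: "pverts X = pverts K \<union> L" "pverts X' = insert w (pverts K \<union> L)"
    by (simp_all add: X_def X'_def)
  have fin: "finite (pverts X)" "finite (pverts X')"
    using verts K.pair_finite_verts finite_L by simp_all
  have pl: "p l \<in> pverts K" "p l \<notin> L" using p_in[OF assms(1)] disjoint by auto
  \<comment> \<open>The relation \<open>A\<close> stands for the arcs of \<open>X\<close> or of
    \<open>X'\<close>. Both satisfy the two conditions: in \<open>X\<close> no arc enters
    \<open>l\<close>, and in \<open>X'\<close> only the one from \<open>w\<close> does.\<close>
  have eq: "x = y"
    if A: "\<And>x. x \<in> L \<Longrightarrow> x \<noteq> l \<Longrightarrow> (a, x) \<in> A \<Longrightarrow> (a, x) \<in> parcs H"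
      and l: "(a, l) \<in> A \<Longrightarrow> a = w"
      and "x \<in> insert l ?P" "y \<in> insert l ?P" "a = x \<or> (a, x) \<in> A" "a = y \<or> (a, y) \<in> A" for A a x y
  proof -
    have P': "z \<in> L \<and> z \<noteq> l \<and> s (p z) = z \<and> p z \<in> pverts K" if "z \<in> ?P" for z
      using that s by auto
    have nb: "a = z \<or> a = p z" if "z \<in> ?P" "a = z \<or> (a, z) \<in> A" for z
      using that P' A leaf_neighbour by blast
    have nl: "a = l \<or> a = w" if "a = l \<or> (a, l) \<in> A"
      using that l by blast
    \<comment> \<open>The closed in-neighbourhood of \<open>l\<close> lies in {\<open>l\<close>,
      \<open>w\<close>}, that of \<open>z\<close> in {\<open>z\<close>, \<open>p z\<close>}. These
      are disjoint since \<open>p z\<close> is in \<open>K\<close>, \<open>l\<close> is a leaf other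
      than \<open>z\<close>, and \<open>w\<close> is outside \<open>H\<close>.\<close>
    have no: False if "z \<in> ?P" "a = z \<or> (a, z) \<in> A" "a = l \<or> (a, l) \<in> A" for z
      using nb[OF that(1,2)] nl[OF that(3)] P'[OF that(1)] lK assms(2) by auto
    show ?thesis
    proof (cases "x = l \<or> y = l")
      case True
      then show ?thesis using that(3-6) no by blast
    next
      case False
      then have "x \<in> ?P" "y \<in> ?P" using that(3,4) by auto
      then show ?thesis
        using parent_eq[of x y a] nb that(5,6) P' by metis
    qed
  qed
  have dominated: "\<exists>c\<in>pverts K. (c, x) \<in> parcs X"
    "\<exists>c\<in>pverts K. (c, x) \<in> parcs X'"
    if "x \<in> L" "x \<noteq> l" for x
  proof -
    have "(p x, x) \<in> parcs X" "(p x, x) \<in> parcs X'"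
      using that pl by (auto simp: X_def X'_def)
    then show "\<exists>c\<in>pverts K. (c, x) \<in> parcs X"
      "\<exists>c\<in>pverts K. (c, x) \<in> parcs X'"
      using p_in[OF that(1)] by - blast+
  qed
  have "domination_number X = card (insert l (pverts K))"
  proof (rule domination_number_eqI[OF _ _ _ card])
    show "dominating_set X (insert l (pverts K))"
      unfolding dominating_set_def verts using dominated(1) assms(1) by auto
    have nl: "(a, l) \<notin> parcs X" for a
      using leaf_neighbour[OF assms(1)] by (auto simp: X_def)
    have sub: "(a, x) \<in> parcs H" if "(a, x) \<in> parcs X" for a x
      using that by (auto simp: X_def)
    show "x = y"
      if "x \<in> insert l ?P" "y \<in> insert l ?P" "a = x \<or> (a, x) \<in> parcs X"
        "a = y \<or> (a, y) \<in> parcs X" for a x y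
      by (rule eq[OF _ _ that]) (use nl sub in blast)+
  qed (use fin P verts assms(1) in auto)
  then show "domination_number (delete_edge H (l, p l)) = Suc (card (pverts K))"
    using cardD X_def by simp
  have "domination_number X' = card (insert l (pverts K))"
  proof (rule domination_number_eqI[OF _ _ _ card])
    \<comment> \<open>Here \<open>l\<close> serves to dominate the new vertex, whereas after the
      deletion it is in the dominating set because it is isolated.\<close>
    have "(l, w) \<in> parcs X'" by (simp add: X'_def)
    then show "dominating_set X' (insert l (pverts K))"
      unfolding dominating_set_def verts using dominated(2) assms(1) by auto
    have nl: "a = w" if "(a, l) \<in> parcs X'" for a
      using that leaf_neighbour[OF assms(1), of a] assms pl by (auto simp: X'_def)
    have sub: "(a, x) \<in> parcs H"
      if "x \<in> L" "x \<noteq> l" "(a, x) \<in> parcs X'" for a x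
      using that assms(2) pl by (auto simp: X'_def)
    show "x = y"
      if "x \<in> insert l ?P" "y \<in> insert l ?P" "a = x \<or> (a, x) \<in> parcs X'"
        "a = y \<or> (a, y) \<in> parcs X'" for a x y
      by (rule eq[OF _ _ that]) (use nl sub in blast)+
  qed (use fin P verts assms(1) in auto)
  then show "domination_number (subdivide H (l, p l) w) = Suc (card (pverts K))"
    using cardD X'_def by simp
qed

lemma two_le_card:
  assumes "pverts K \<noteq> {}"
  shows "2 \<le> card (pverts H)"
proof -
  obtain v where v: "v \<in> pverts K" using assms by blast
  then obtain x where "x \<in> L" using other_leaf by blast
  then have "{v, x} \<subseteq> pverts H" "v \<noteq> x" using v disjoint by auto
  then show ?thesis
    using card_mono[of "pverts H" "{v, x}"] K.pair_finite_verts finite_L by simp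
qed

end

section \<open>The SR property\<close>

lemma SR_graph_attach_leaves:
  fixes K :: "'a::infinite pair_pre_digraph"
  assumes "two_leaves K p L" and con: "Digraph_Component.connected (with_proj K)"
  shows "SR_graph (attach_leaves K p L)"
proof -
  interpret two_leaves K p L by fact
  have "domination_number (delete_edge H e) = domination_number (subdivide H e w)"
    if e: "e \<in> parcs H" and w: "w \<notin> pverts H" for e w
  proof -
    \<comment> \<open>An edge at a leaf occurs as two arcs; both operations are blind to the
      orientation, so the third case reduces to the second.\<close>
    consider "e \<in> parcs K" | l where "l \<in> L" "e = (l, p l)" | l where "l \<in> L" "e = (p l, l)"
      using e by auto
    then show ?thesis
    proof cases
      case 1
      then show ?thesis using inner_edge w by (cases e) simp
    next
      case 2
      then show ?thesis using leaf_edge w by simp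
    next
      case 3
      then show ?thesis
        using leaf_edge w delete_edge_swap[of H "p l" l] subdivide_swap[of H "p l" l w] by simp
    qed
  qed
  moreover have "pverts K \<noteq> {}" using con by (simp add: connected_conv)
  ultimately show ?thesis
    using pair_graph_H connected_H[OF con] two_le_card by (auto simp: SR_graph_def)
qed

section \<open>Renaming vertices to make room for leaves\<close>

text \<open>Lets the given graph be moved to a vertex set whose complement has a convenient supply
  of leaves.\<close>

lemma pair_graph_image:
  assumes "pair_graph G" "inj_on f (pverts G)"
  defines "K \<equiv> \<lparr> pverts = f ` pverts G, parcs = map_prod f f ` parcs G \<rparr>"
  shows "pair_graph K" "digraph_iso (with_proj G) (with_proj K)"
    "Digraph_Component.connected (with_proj G) \<Longrightarrow> Digraph_Component.connected (with_proj K)"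
proof -
  interpret G: pair_graph G by fact
  have "symmetric (with_proj K)"
    unfolding symmetric_def with_proj_simps
  proof (rule symI)
    fix a b assume "(a, b) \<in> parcs K"
    then obtain x y where "(x, y) \<in> parcs G" "a = f x" "b = f y" by (auto simp: K_def)
    then show "(b, a) \<in> parcs K"
      using G.arcs_symmetric[of x y] by (auto simp: K_def intro: rev_image_eqI)
  qed
  then show "pair_graph K"
    using G.pair_finite_verts G.pair_finite_arcs assms(2)
    by unfold_locales (auto simp: K_def dest: G.wellformed' G.no_loops', metis G.no_loops' G.wellformed' inj_onD)
  \<comment> \<open>With the projections as head and tail maps, the image under \<open>h\<close>
    equals \<open>with_proj K\<close> itself, so connectedness transfers along
    \<open>h\<close>.\<close>
  define h where "h = \<lparr> iso_verts = f, iso_arcs = map_prod f f, iso_head = snd, iso_tail = fst \<rparr>"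
  have "parcs G \<subseteq> pverts G \<times> pverts G" by (auto dest: G.wellformed')
  then have "inj_on (map_prod f f) (parcs G)"
    using map_prod_inj_on[OF assms(2) assms(2)] inj_on_subset by blast
  then have h: "pre_digraph.digraph_isomorphism (with_proj G) h"
    using assms(2) G.wf_digraph by (auto simp: pre_digraph.digraph_isomorphism_def h_def)
  have K: "with_proj K = app_iso h (with_proj G)"
    by (simp add: with_proj_def app_iso_def h_def K_def)
  show "digraph_iso (with_proj G) (with_proj K)"
    using h K by (auto simp: digraph_iso_def)
  show "Digraph_Component.connected (with_proj K)" if "Digraph_Component.connected (with_proj G)"
    using wf_digraph.connectedI_app_iso[OF G.wf_digraph that h] K by simp
qed

theorem corollary6:
  fixes G :: "'a pair_pre_digraph"
  assumes "pair_graph G"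
    and "Digraph_Component.connected (with_proj G)"
  shows "\<exists>(H :: nat pair_pre_digraph) (K :: nat pair_pre_digraph).
           SR_graph H \<and> induced_subgraph (with_proj K) (with_proj H) \<and>
           digraph_iso (with_proj G) (with_proj K)"
proof -
  interpret G: pair_graph G by fact
  obtain g :: "'a \<Rightarrow> nat" where g: "inj_on g (pverts G)"
    using finite_imp_inj_to_nat_seg[OF G.pair_finite_verts] by blast
  \<comment> \<open>Multiples of 3 leave two free numbers after each vertex. These become its
    leaves, and \<open>p\<close> recovers the parent by rounding down to a multiple of 3.\<close>
  define f where "f x = 3 * g x" for x
  have f: "inj_on f (pverts G)" using g by (auto simp: f_def inj_on_def)
  define K where "K = \<lparr> pverts = f ` pverts G, parcs = map_prod f f ` parcs G \<rparr>"
  note K = pair_graph_image[OF assms(1) f, folded K_def]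
  interpret K: pair_graph K by (rule K(1))
  define p :: "nat \<Rightarrow> nat" where "p x = 3 * (x div 3)" for x
  define L where "L = Suc ` pverts K \<union> (\<lambda>x. x + 2) ` pverts K"
  have dvd: "3 dvd x" if "x \<in> pverts K" for x
    using that by (auto simp: K_def f_def)
  have p: "p (Suc x) = x" "p (x + 2) = x" if "x \<in> pverts K" for x
    using dvd[OF that] by (auto simp: p_def)
  interpret two_leaves K p L
  proof
    show "finite L" using K.pair_finite_verts by (simp add: L_def)
    have "\<not> 3 dvd Suc x" "\<not> 3 dvd x + 2" if "x \<in> pverts K" for x
      using dvd[OF that] by presburger+
    then have "\<not> 3 dvd x" if "x \<in> L" for x
      using that unfolding L_def by blast
    then show "L \<inter> pverts K = {}" using dvd by blast
    show "p x \<in> pverts K" if "x \<in> L" for x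
      using that p by (auto simp: L_def)
    show "\<exists>x\<in>L. x \<noteq> l \<and> p x = v" if "v \<in> pverts K" for v l
    \<comment> \<open>Of the two leaves \<open>Suc v\<close> and \<open>v + 2\<close>, one that
      differs from \<open>l\<close> is taken.\<close>
    proof (cases "l = Suc v")
      case True
      then show ?thesis using that p by (intro bexI[of _ "v + 2"]) (auto simp: L_def)
    next
      case False
      then show ?thesis using that p by (intro bexI[of _ "Suc v"]) (auto simp: L_def)
    qed
  qed
  show ?thesis
    using SR_graph_attach_leaves[OF two_leaves_axioms K(3)[OF assms(2)]] induced_subgraph_H K(2)
    by blast
qed

end
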